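(* Let $(S,\mathcal{A},\mu)$ be a complete, finite measure space, $1\leq p<\infty$ and $X$ a Banach space with the Opial property. Let $(f_n)_{n\in\mathbb{N}}$ be a bounded sequence in $L^p(\mu,X)$ such that $(f_n(t))_{n\in\mathbb{N}}$ converges weakly to zero for almost every $t\in S$. Suppose further that there is a function $g\in L^p(\mu)$ such that $\|f_n(t)\|\to g(t)$ for almost every $t\in S$. Then $$\limsup_{n\to\infty}\|f_n\|_p<\limsup_{n\to\infty}\|f_n-f\|_p\quad\text{for all } f\in L^p(\mu,X)\setminus\{0\}.$$
   Context: All Banach spaces are real. The Lebesgue-Bochner space $L^p(\mu,X)$ is the space of all Bochner-measurable functions $f:S\to X$ (modulo equality $\mu$-almost everywhere) with $\|f(\cdot)\|\in L^p(\mu)$, normed by $\|f\|_p:=\|\,\|f(\cdot)\|\,\|_p$. A Banach space $X$ has the Opial property if $\limsup_{n\to\infty}\|x_n\|<\limsup_{n\to\infty}\|x_n-x\|$ holds for every weakly null sequence $(x_n)_{n\in\mathbb{N}}$ in $X$ and every $x\in X\setminus\{0\}$ (one may equivalently use $\liminf$ instead of $\limsup$). *)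

theory Defs
  imports "HOL-Analysis.Analysis"
begin

text \<open>
  Elements of \<open>L\<^sup>p(\<mu>)\<close> and \<open>L\<^sup>p(\<mu>, X)\<close> are handled through representatives: functions
  that are equal almost everywhere stand for the same element, so a representative \<open>f\<close> is
  the zero element iff \<open>f t = 0\<close> for almost every \<open>t\<close>.
\<close>

definition Lp_real :: "'s measure \<Rightarrow> real \<Rightarrow> ('s \<Rightarrow> real) set" where
  "Lp_real M p = {g. g \<in> borel_measurable M \<and> integrable M (\<lambda>t. \<bar>g t\<bar> powr p)}"

definition Lp_real_norm :: "'s measure \<Rightarrow> real \<Rightarrow> ('s \<Rightarrow> real) \<Rightarrow> real" where
  "Lp_real_norm M p g = (\<integral>t. \<bar>g t\<bar> powr p \<partial>M) powr (1 / p)"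

text \<open>
  Borel measurability would not suffice here, since \<open>X\<close> need not be separable: a
  Bochner-measurable function is an almost everywhere limit of simple functions.
\<close>

definition bochner_measurable :: "'s measure \<Rightarrow> ('s \<Rightarrow> 'a::real_normed_vector) \<Rightarrow> bool" where
  "bochner_measurable M f \<longleftrightarrow>
     (\<exists>s. (\<forall>i. simple_function M (s i)) \<and> (AE t in M. (\<lambda>i. s i t) \<longlonglongrightarrow> f t))"

definition Lp :: "'s measure \<Rightarrow> real \<Rightarrow> ('s \<Rightarrow> 'a::real_normed_vector) set" where
  "Lp M p = {f. bochner_measurable M f \<and> (\<lambda>t. norm (f t)) \<in> Lp_real M p}"

definition Lp_norm :: "'s measure \<Rightarrow> real \<Rightarrow> ('s \<Rightarrow> 'a::real_normed_vector) \<Rightarrow> real" where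
  "Lp_norm M p f = Lp_real_norm M p (\<lambda>t. norm (f t))"

definition weakly_null :: "(nat \<Rightarrow> 'a::real_normed_vector) \<Rightarrow> bool" where
  "weakly_null x \<longleftrightarrow> (\<forall>\<phi> :: 'a \<Rightarrow> real. bounded_linear \<phi> \<longrightarrow> (\<lambda>n. \<phi> (x n)) \<longlonglongrightarrow> 0)"

definition opial_property :: "'a::real_normed_vector itself \<Rightarrow> bool" where
  "opial_property _ \<longleftrightarrow>
     (\<forall>(x :: nat \<Rightarrow> 'a) z. weakly_null x \<longrightarrow> z \<noteq> 0 \<longrightarrow>
        limsup (\<lambda>n. ereal (norm (x n))) < limsup (\<lambda>n. ereal (norm (x n - z))))"

end

theory Submission
  imports Defs
begin

text \<open>
  Write \<open>a\<^sub>n = \<parallel>F\<^sub>n(t)\<parallel>\<^sup>p\<close>, \<open>b\<^sub>n = \<parallel>F\<^sub>n(t) - f(t)\<parallel>\<^sup>p\<close> and \<open>A = g\<^sup>p\<close>. The Opial property of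
  \<open>X\<close>, applied at almost every point, says that the lower limit of \<open>b\<^sub>n\<close> is at least \<open>A\<close> and
  exceeds \<open>A\<close> wherever \<open>f \<noteq> 0\<close>, a set that is not null; the lower limit may be used
  in place of the upper one because \<open>\<parallel>F\<^sub>n(t)\<parallel>\<close> converges (\<open>opial_liminf\<close>).

  What remains is to pass to integrals. Fatou's lemma for \<open>b\<^sub>n\<close> alone is not enough: it compares
  the lower limit of \<open>\<integral>b\<^sub>n\<close> with \<open>\<integral>A\<close>, whereas \<open>\<integral>a\<^sub>n\<close> may stay well above \<open>\<integral>A\<close>,
  because mass of \<open>a\<^sub>n\<close> may concentrate on small sets. Fatou's lemma is needed for the difference
  \<open>b\<^sub>n - a\<^sub>n\<close>, which may lack an integrable lower bound when \<open>p > 1\<close>. As in the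
  Brezis-Lieb lemma, convexity of the \<open>p\<close>-th power provides one at the price of a
  constant \<open>c\<close> slightly smaller than \<open>1\<close>:
  \<open>b\<^sub>n - c a\<^sub>n \<ge> - C \<parallel>f\<parallel>\<^sup>p\<close> (\<open>norm_powr_diff_lower_bound\<close>). Since the integrals of \<open>a\<^sub>n\<close>
  are bounded, replacing \<open>a\<^sub>n\<close> by \<open>c a\<^sub>n\<close> costs little, and so \<open>\<integral>b\<^sub>n\<close> eventually exceeds
  \<open>\<integral>a\<^sub>n\<close> by a fixed amount (\<open>integral_gap_of_liminf_gap\<close>). On bounded sets such a gap between
  \<open>p\<close>-th powers is a uniform gap between the norms themselves (\<open>uniform_root_gap\<close>), which is
  inherited by the upper limits.
\<close>

section \<open>Elementary inequalities for powers\<close>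

text \<open>
  Convexity of the \<open>p\<close>-th power for \<open>a + b = (1 - l) (a / (1 - l)) + l (b / l)\<close>. As \<open>l\<close> tends
  to \<open>0\<close> the coefficient of \<open>a\<close> tends to \<open>1\<close>, whereas that of \<open>b\<close> blows up if \<open>p > 1\<close>.
\<close>
lemma powr_sum_le_weighted:
  fixes a b l p :: real
  assumes p: "1 \<le> p" and a: "0 \<le> a" and b: "0 \<le> b" and l: "0 < l" "l < 1"
  shows "(a + b) powr p \<le> (1 - l) powr (1 - p) * a powr p + l powr (1 - p) * b powr p"
proof -
  have one_le: "1 \<le> x powr (1 - p)" if "0 < x" "x < 1" for x :: real
    using powr_mono2'[of "1 - p" x 1] that p by simp
  have mult_le: "y powr p \<le> x powr (1 - p) * y powr p" if "0 < x" "x < 1" for x y :: real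
    using mult_right_mono[OF one_le[OF that], of "y powr p"] by simp
  show ?thesis
  \<comment> \<open>Convexity of the power is at hand on the open half-line only, so zeros are treated apart.\<close>
  proof (cases "a = 0 \<or> b = 0")
    case True
    then show ?thesis
      using mult_le[of l b] mult_le[of "1 - l" a] l by (elim disjE) simp_all
  next
    case False
    then have ab: "0 < a" "0 < b" using a b by auto
    have scale: "x * (y / x) powr p = x powr (1 - p) * y powr p" if "0 < x" "0 < y" for x y :: real
      using that by (simp add: powr_divide powr_diff)
    have "((1 - l) *\<^sub>R (a / (1 - l)) + l *\<^sub>R (b / l)) powr p
        \<le> (1 - l) * (a / (1 - l)) powr p + l * (b / l) powr p"
      by (rule convex_onD[OF powr_convex[OF p]]) (use ab l in auto)
    moreover have "(1 - l) *\<^sub>R (a / (1 - l)) + l *\<^sub>R (b / l) = a + b"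
      using l by simp
    ultimately show ?thesis
      using scale[of l b] scale[of "1 - l" a] ab l by simp
  qed
qed

text \<open>
  The integrable minorant that makes Fatou's lemma applicable: it comes from the weighted
  inequality for \<open>\<parallel>u\<parallel> \<le> \<parallel>u - v\<parallel> + \<parallel>v\<parallel>\<close>. For \<open>p > 1\<close> the value \<open>c = 1\<close> is out of reach, since
  \<open>\<parallel>u\<parallel>\<^sup>p - \<parallel>u - v\<parallel>\<^sup>p\<close> may grow like \<open>\<parallel>u\<parallel>\<^sup>p\<^sup>-\<^sup>1 \<parallel>v\<parallel>\<close>.
\<close>
lemma norm_powr_diff_lower_bound:
  fixes c p :: real
  assumes p: "1 \<le> p" and c: "0 < c" "c < 1"
  shows "\<exists>C\<ge>0. \<forall>u v :: 'a::real_normed_vector.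
           c * norm u powr p \<le> norm (u - v) powr p + C * norm v powr p"
proof -
  \<comment> \<open>The weighted inequality yields the factor \<open>(1 - l)\<^sup>p\<^sup>-\<^sup>1\<close>; this \<open>l\<close> solves \<open>(1 - l)\<^sup>p = c\<close>,
    which is positive also for \<open>p = 1\<close> and gives a factor of at least \<open>c\<close>.\<close>
  define l where "l = 1 - c powr (1 / p)"
  have "c powr (1 / p) < 1" "0 < c powr (1 / p)"
    using powr_less_mono2[of "1/p" c 1] p c by auto
  then have l: "0 < l" "l < 1" by (auto simp: l_def)
  define k where "k = (1 - l) powr (p - 1)"
  have k: "0 < k" "k * (1 - l) powr (1 - p) = 1"
    using l by (auto simp: k_def simp flip: powr_add)
  have "c = (1 - l) powr p"
    using p c by (simp add: l_def powr_powr)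
  also have "\<dots> \<le> k"
    unfolding k_def by (rule powr_mono') (use l in auto)
  finally have ck: "c \<le> k" .
  have "c * norm u powr p \<le> norm (u - v) powr p + (k * l powr (1 - p)) * norm v powr p"
    for u v :: 'a
  proof -
    have "norm u \<le> norm (u - v) + norm v"
      using norm_triangle_ineq[of "u - v" v] by simp
    then have "norm u powr p \<le> (norm (u - v) + norm v) powr p"
      using p by (intro powr_mono2) auto
    also have "\<dots> \<le> (1 - l) powr (1 - p) * norm (u - v) powr p + l powr (1 - p) * norm v powr p"
      by (rule powr_sum_le_weighted) (use p l in auto)
    finally have "k * norm u powr p
        \<le> k * ((1 - l) powr (1 - p) * norm (u - v) powr p + l powr (1 - p) * norm v powr p)"
      using k by (intro mult_left_mono) auto
    also have "\<dots> = (k * (1 - l) powr (1 - p)) * norm (u - v) powr p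
        + (k * l powr (1 - p)) * norm v powr p"
      by (simp add: algebra_simps)
    finally have "k * norm u powr p \<le> norm (u - v) powr p + (k * l powr (1 - p)) * norm v powr p"
      using k by simp
    moreover have "c * norm u powr p \<le> k * norm u powr p"
      using ck by (intro mult_right_mono) auto
    ultimately show ?thesis by linarith
  qed
  then show ?thesis
    using k by (intro exI[of _ "k * l powr (1 - p)"]) auto
qed

lemma norm_diff_powr_le:
  fixes u v :: "'a::real_normed_vector" and p :: real
  assumes p: "1 \<le> p"
  shows "norm (u - v) powr p \<le> (1/2) powr (1 - p) * (norm u powr p + norm v powr p)"
proof -
  have "norm (u - v) powr p \<le> (norm u + norm v) powr p"
    using p by (intro powr_mono2 norm_triangle_ineq4) auto
  also have "\<dots> \<le> (1 - 1/2) powr (1 - p) * norm u powr p + (1/2) powr (1 - p) * norm v powr p"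
    by (rule powr_sum_le_weighted) (use p in auto)
  finally show ?thesis by (simp add: algebra_simps)
qed

text \<open>
  The function \<open>(r\<^sup>p + d)\<^sup>1\<^sup>/\<^sup>p - r\<close> is continuous and positive, hence bounded away from \<open>0\<close> on
  the compact interval \<open>[0, K]\<close>. For \<open>p > 1\<close> it tends to \<open>0\<close> at infinity, so the gap depends on \<open>K\<close>.
\<close>
lemma uniform_root_gap:
  fixes p d K :: real
  assumes p: "1 \<le> p" and d: "0 < d" and K: "0 \<le> K"
  shows "\<exists>\<eta>>0. \<forall>r s. 0 \<le> r \<longrightarrow> r \<le> K \<longrightarrow> 0 \<le> s \<longrightarrow> r powr p + d \<le> s powr p \<longrightarrow> r + \<eta> \<le> s"
proof -
  define gap where "gap r = (r powr p + d) powr (1 / p) - r" for r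
  have "continuous_on {0..K} gap"
    unfolding gap_def by (intro continuous_intros continuous_on_powr') (use p d in \<open>auto intro: add_nonneg_pos\<close>)
  then obtain m where m: "m \<in> {0..K}" "\<And>r. r \<in> {0..K} \<Longrightarrow> gap m \<le> gap r"
    using continuous_attains_inf[of "{0..K}" gap] K by auto
  have "(m powr p) powr (1 / p) < (m powr p + d) powr (1 / p)"
    using p d by (intro powr_less_mono2) auto
  then have "0 < gap m"
    using p m(1) by (simp add: gap_def powr_powr)
  moreover have "r + gap m \<le> s"
    if "0 \<le> r" "r \<le> K" "0 \<le> s" "r powr p + d \<le> s powr p" for r s
  proof -
    have "(r powr p + d) powr (1 / p) \<le> (s powr p) powr (1 / p)"
      using that p d by (intro powr_mono2) auto
    then have "gap r \<le> s - r"
      using p that by (simp add: gap_def powr_powr)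
    then show ?thesis using m(2)[of r] that by auto
  qed
  ultimately show ?thesis by blast
qed

section \<open>The Opial property in terms of lower limits\<close>

text \<open>
  A subsequence that realises the lower limit of \<open>\<parallel>x\<^sub>n - z\<parallel>\<close> is again weakly null, and its norms
  still tend to \<open>L\<close>; along it, both upper limits in the Opial property are limits.
\<close>
lemma opial_liminf:
  fixes x :: "nat \<Rightarrow> 'a::real_normed_vector"
  assumes opial: "opial_property TYPE('a)" and x: "weakly_null x" and z: "z \<noteq> 0"
    and L: "(\<lambda>n. norm (x n)) \<longlonglongrightarrow> L"
  shows "ereal L < liminf (\<lambda>n. ereal (norm (x n - z)))"
proof -
  obtain r where r: "strict_mono r"
    and lim: "((\<lambda>n. ereal (norm (x n - z))) \<circ> r) \<longlonglongrightarrow> liminf (\<lambda>n. ereal (norm (x n - z)))"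
    using liminf_subseq_lim by blast
  have "weakly_null (x \<circ> r)"
    using x LIMSEQ_subseq_LIMSEQ[OF _ r] by (auto simp: weakly_null_def o_def)
  then have "limsup (\<lambda>n. ereal (norm ((x \<circ> r) n))) < limsup (\<lambda>n. ereal (norm ((x \<circ> r) n - z)))"
    using opial z unfolding opial_property_def by blast
  moreover have "limsup (\<lambda>n. ereal (norm ((x \<circ> r) n))) = ereal L"
    using LIMSEQ_subseq_LIMSEQ[OF L r] by (intro lim_imp_Limsup) (auto simp: o_def)
  moreover have "limsup (\<lambda>n. ereal (norm ((x \<circ> r) n - z))) = liminf (\<lambda>n. ereal (norm (x n - z)))"
    using lim by (intro lim_imp_Limsup) (auto simp: o_def)
  ultimately show ?thesis by simp
qed

text \<open>
  A number strictly between \<open>L\<close> and the lower limit carries the strict inequality over to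
  \<open>p\<close>-th powers.
\<close>
lemma opial_liminf_powr:
  fixes x :: "nat \<Rightarrow> 'a::real_normed_vector" and p :: real
  assumes p: "1 \<le> p"
    and opial: "opial_property TYPE('a)" and x: "weakly_null x" and z: "z \<noteq> 0"
    and L: "(\<lambda>n. norm (x n)) \<longlonglongrightarrow> L"
  shows "ennreal (L powr p) < liminf (\<lambda>n. ennreal (norm (x n - z) powr p))"
proof -
  have L0: "0 \<le> L"
    by (rule LIMSEQ_le_const[OF L]) auto
  obtain m where m: "L < m" "ereal m < liminf (\<lambda>n. ereal (norm (x n - z)))"
    using ereal_dense2[OF opial_liminf[OF opial x z L]] by auto
  have "\<forall>\<^sub>F n in sequentially. ereal m < ereal (norm (x n - z))"
    by (rule less_LiminfD[OF m(2)])
  then have "\<forall>\<^sub>F n in sequentially. ennreal (m powr p) \<le> ennreal (norm (x n - z) powr p)"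
    by eventually_elim (use p m L0 in \<open>auto intro!: ennreal_leI powr_mono2\<close>)
  then have "ennreal (m powr p) \<le> liminf (\<lambda>n. ennreal (norm (x n - z) powr p))"
    by (rule Liminf_bounded)
  moreover have "ennreal (L powr p) < ennreal (m powr p)"
    using p m L0 by (intro ennreal_lessI powr_less_mono2) (auto intro: powr_gt_zero)
  ultimately show ?thesis by simp
qed

section \<open>A gap between integrals\<close>

lemma liminf_add_tendsto_le:
  fixes u v :: "nat \<Rightarrow> ennreal"
  assumes v: "v \<longlonglongrightarrow> l"
  shows "liminf (\<lambda>n. u n + v n) \<le> liminf u + l"
proof -
  obtain r where r: "strict_mono r" and lim: "(u \<circ> r) \<longlonglongrightarrow> liminf u"
    using liminf_subseq_lim by blast
  have "((\<lambda>n. u n + v n) \<circ> r) \<longlonglongrightarrow> liminf u + l"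
    using tendsto_add[OF lim LIMSEQ_subseq_LIMSEQ[OF v r]] by (simp add: o_def)
  then have "liminf ((\<lambda>n. u n + v n) \<circ> r) = liminf u + l"
    by (intro lim_imp_Liminf) auto
  then show ?thesis
    using liminf_subseq_mono[OF r, of "\<lambda>n. u n + v n"] by simp
qed

text \<open>
  Fatou's lemma is applied to \<open>b\<^sub>n + C h - c a\<^sub>n \<ge> 0\<close> with \<open>c\<close> just below \<open>1\<close>. It gives, up to
  small errors, that the lower limit of \<open>\<integral>b\<^sub>n - c \<integral>a\<^sub>n\<close> is at least \<open>\<integral>(liminf b\<^sub>n) - c \<integral>A\<close>,
  which is positive by the pointwise gap. Bounded integrals of \<open>a\<^sub>n\<close> keep
  \<open>(1 - c) \<integral>a\<^sub>n\<close> below any prescribed size. All estimates with lower limits take place in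
  the extended nonnegative reals, because \<open>\<integral>(liminf b\<^sub>n)\<close> may be infinite a priori.
\<close>
lemma integral_gap_of_liminf_gap:
  fixes a b :: "nat \<Rightarrow> 's \<Rightarrow> real" and A h :: "'s \<Rightarrow> real"
  assumes a: "\<And>n. integrable M (a n)" "\<And>n t. 0 \<le> a n t"
    and b: "\<And>n. integrable M (b n)" "\<And>n t. 0 \<le> b n t"
    and h: "integrable M h" "\<And>t. 0 \<le> h t"
    and A: "integrable M A" "AE t in M. 0 \<le> A t"
    and K: "\<And>n. (\<integral>t. a n t \<partial>M) \<le> K"
    and lower: "\<And>c. 0 < c \<Longrightarrow> c < 1 \<Longrightarrow> \<exists>C\<ge>0. \<forall>n t. c * a n t \<le> b n t + C * h t"
    and lim: "AE t in M. (\<lambda>n. a n t) \<longlonglongrightarrow> A t"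
    and le: "AE t in M. ennreal (A t) \<le> liminf (\<lambda>n. ennreal (b n t))"
    and gap: "\<not> (AE t in M. liminf (\<lambda>n. ennreal (b n t)) \<le> ennreal (A t))"
  shows "\<exists>d>0. \<forall>\<^sub>F n in sequentially. (\<integral>t. a n t \<partial>M) + d \<le> (\<integral>t. b n t \<partial>M)"
proof -
  have [measurable]: "a n \<in> borel_measurable M" "b n \<in> borel_measurable M"
    "h \<in> borel_measurable M" "A \<in> borel_measurable M" for n
    using a b h A by auto
  define B where "B t = liminf (\<lambda>n. ennreal (b n t))" for t
  have [measurable]: "B \<in> borel_measurable M"
    unfolding B_def by measurable
  define IA where "IA = (\<integral>t. A t \<partial>M)"
  define H where "H = (\<integral>t. h t \<partial>M)"
  have IA0: "0 \<le> IA" unfolding IA_def using A by (intro integral_nonneg_AE)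
  have H0: "0 \<le> H" unfolding H_def using h by (intro integral_nonneg_AE) auto
  have nnA: "(\<integral>\<^sup>+t. ennreal (A t) \<partial>M) = ennreal IA"
    unfolding IA_def using A by (intro nn_integral_eq_integral)
  have "(\<integral>\<^sup>+t. ennreal (A t) \<partial>M) < (\<integral>\<^sup>+t. B t \<partial>M)"
    by (rule nn_integral_less) (use nnA le gap in \<open>auto simp: B_def\<close>)
  then have "ennreal IA < (\<integral>\<^sup>+t. B t \<partial>M)" by (simp add: nnA)
  then obtain D' where D': "ennreal IA < D'" "D' < (\<integral>\<^sup>+t. B t \<partial>M)"
    using dense by blast
  then obtain D where D: "D' = ennreal D" "0 \<le> D"
    by (cases D') auto
  have D_IA: "IA < D" using D' D IA0 by (simp add: ennreal_less_iff)
  \<comment> \<open>One part of the gap pays for the constant \<open>c\<close>, one for passing from the lower limit to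
    almost all \<open>n\<close>.\<close>
  define d where "d = (D - IA) / 4"
  have "4 * d = D - IA" by (simp add: d_def)
  then have d: "0 < d" "D = IA + 4 * d" using D_IA by linarith+
  have K0: "0 \<le> K"
  proof (rule order_trans)
    show "0 \<le> (\<integral>t. a 0 t \<partial>M)" by (intro integral_nonneg_AE AE_I2 a)
  qed (rule K)
  \<comment> \<open>Chosen so that \<open>(1 - c) K \<le> d\<close>; the minimum with \<open>1/2\<close> keeps \<open>c\<close> positive.\<close>
  define c where "c = 1 - min (1/2) (d / (K + 1))"
  have c: "0 < c" "c < 1" using d K0 by (auto simp: c_def)
  have "(1 - c) * K \<le> d / (K + 1) * K"
    using K0 by (intro mult_right_mono) (auto simp: c_def)
  also have "\<dots> \<le> d" using K0 d by (simp add: field_simps)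
  finally have cK: "(1 - c) * K \<le> d" .
  obtain C where C: "0 \<le> C" "\<And>n t. c * a n t \<le> b n t + C * h t"
    using lower[OF c] by blast
  define \<phi> where "\<phi> n t = b n t + C * h t - c * a n t" for n t
  have \<phi>0: "0 \<le> \<phi> n t" for n t using C(2)[of n t] by (simp add: \<phi>_def)
  have [measurable]: "\<phi> n \<in> borel_measurable M" for n unfolding \<phi>_def by measurable
  have int_\<phi>: "(\<integral>\<^sup>+t. ennreal (\<phi> n t) \<partial>M)
      = ennreal ((\<integral>t. b n t \<partial>M) + C * H - c * (\<integral>t. a n t \<partial>M))" for n
  proof -
    have "(\<integral>\<^sup>+t. ennreal (\<phi> n t) \<partial>M) = ennreal (\<integral>t. \<phi> n t \<partial>M)"
      unfolding \<phi>_def using a b h \<phi>0[unfolded \<phi>_def] by (intro nn_integral_eq_integral) auto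
    also have "(\<integral>t. \<phi> n t \<partial>M) = (\<integral>t. b n t \<partial>M) + C * H - c * (\<integral>t. a n t \<partial>M)"
      unfolding \<phi>_def H_def using a b h by simp
    finally show ?thesis .
  qed
  have pointwise: "AE t in M. B t + ennreal (C * h t)
      \<le> liminf (\<lambda>n. ennreal (\<phi> n t)) + ennreal (c * A t)"
    using lim
  proof eventually_elim
    case (elim t)
    have "B t + ennreal (C * h t) = liminf (\<lambda>n. ennreal (b n t) + ennreal (C * h t))"
      unfolding B_def by (rule Liminf_add_const[symmetric]) auto
    also have "\<dots> = liminf (\<lambda>n. ennreal (\<phi> n t) + ennreal (c * a n t))"
      using \<phi>0 a b C h c by (simp add: \<phi>_def flip: ennreal_plus)
    also have "\<dots> \<le> liminf (\<lambda>n. ennreal (\<phi> n t)) + ennreal (c * A t)"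
      by (intro liminf_add_tendsto_le tendsto_intros elim)
    finally show ?case .
  qed
  have CH: "(\<integral>\<^sup>+t. ennreal (C * h t) \<partial>M) = ennreal (C * H)"
    unfolding H_def using h C by (subst nn_integral_eq_integral) auto
  have cA: "(\<integral>\<^sup>+t. ennreal (c * A t) \<partial>M) = ennreal (c * IA)"
    unfolding IA_def using A c by (subst nn_integral_eq_integral) auto
  have "ennreal D + ennreal (C * H) \<le> (\<integral>\<^sup>+t. B t \<partial>M) + ennreal (C * H)"
    using D' D by (intro add_right_mono) auto
  also have "\<dots> = (\<integral>\<^sup>+t. B t + ennreal (C * h t) \<partial>M)"
    unfolding CH[symmetric] by (intro nn_integral_add[symmetric]) auto
  also have "\<dots> \<le> (\<integral>\<^sup>+t. liminf (\<lambda>n. ennreal (\<phi> n t)) + ennreal (c * A t) \<partial>M)"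
    by (rule nn_integral_mono_AE[OF pointwise])
  also have "\<dots> = (\<integral>\<^sup>+t. liminf (\<lambda>n. ennreal (\<phi> n t)) \<partial>M) + ennreal (c * IA)"
    unfolding cA[symmetric] by (intro nn_integral_add) auto
  also have "\<dots> \<le> liminf (\<lambda>n. \<integral>\<^sup>+t. ennreal (\<phi> n t) \<partial>M) + ennreal (c * IA)"
    by (intro add_right_mono nn_integral_liminf) auto
  finally have fatou: "ennreal D + ennreal (C * H)
      \<le> liminf (\<lambda>n. \<integral>\<^sup>+t. ennreal (\<phi> n t) \<partial>M) + ennreal (c * IA)" .
  have cIA: "c * IA \<le> IA" "0 \<le> c * IA" using c IA0 by (auto simp: mult_left_le_one_le)
  have CH0: "0 \<le> C * H" using C H0 by auto
  define E where "E = D + C * H - c * IA - d"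
  have E0: "0 \<le> E" unfolding E_def using cIA CH0 d IA0 by linarith
  have "ennreal E < liminf (\<lambda>n. \<integral>\<^sup>+t. ennreal (\<phi> n t) \<partial>M)"
  proof (rule ccontr)
    assume "\<not> ?thesis"
    then have "liminf (\<lambda>n. \<integral>\<^sup>+t. ennreal (\<phi> n t) \<partial>M) + ennreal (c * IA) \<le> ennreal E + ennreal (c * IA)"
      by (intro add_right_mono) auto
    with fatou have "ennreal D + ennreal (C * H) \<le> ennreal E + ennreal (c * IA)"
      by (rule order_trans)
    then have "D + C * H \<le> E + c * IA"
      using D E0 CH0 cIA by (simp flip: ennreal_plus)
    then show False unfolding E_def using d(1) by linarith
  qed
  then have "\<forall>\<^sub>F n in sequentially. ennreal E < (\<integral>\<^sup>+t. ennreal (\<phi> n t) \<partial>M)"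
    by (rule less_LiminfD)
  then have "\<forall>\<^sub>F n in sequentially. (\<integral>t. a n t \<partial>M) + d \<le> (\<integral>t. b n t \<partial>M)"
  proof eventually_elim
    case (elim n)
    then have "E < (\<integral>t. b n t \<partial>M) + C * H - c * (\<integral>t. a n t \<partial>M)"
      using E0 by (simp add: int_\<phi> ennreal_less_iff)
    moreover have "(1 - c) * (\<integral>t. a n t \<partial>M) \<le> d"
      using mult_left_mono[OF K[of n], of "1 - c"] cK c by linarith
    ultimately show ?case
      unfolding E_def left_diff_distrib mult_1_left using cIA d by linarith
  qed
  then show ?thesis using d by blast
qed

section \<open>Bochner measurability of norms of differences\<close>

lemma (in complete_measure) borel_measurable_AE_cong:
  fixes f g :: "'a \<Rightarrow> 'b::topological_space"
  assumes f: "f \<in> borel_measurable M" and eq: "AE t in M. f t = g t"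
  shows "g \<in> borel_measurable M"
proof (rule measurableI)
  fix U :: "'b set" assume "U \<in> sets borel"
  then have "f -` U \<inter> space M \<in> sets M"
    using f by (rule measurable_sets[rotated])
  then show "g -` U \<inter> space M \<in> sets M"
    by (rule in_sets_AE[rotated]) (use eq in auto)
qed auto

text \<open>
  In a nonseparable space differences of Borel measurable functions need not be Borel measurable,
  so the approximation by simple functions has to be used. Norms of
  differences of simple functions are measurable and converge almost everywhere, which suffices on
  a complete measure space.
\<close>
lemma bochner_measurable_norm_diff:
  assumes "complete_measure M" and f: "bochner_measurable M f" and g: "bochner_measurable M g"
  shows "(\<lambda>t. norm (f t - g t)) \<in> borel_measurable M"
proof -
  interpret complete_measure M by fact
  obtain s where s: "\<And>i. simple_function M (s i)" "AE t in M. (\<lambda>i. s i t) \<longlonglongrightarrow> f t"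
    using f by (auto simp: bochner_measurable_def)
  obtain u where u: "\<And>i. simple_function M (u i)" "AE t in M. (\<lambda>i. u i t) \<longlonglongrightarrow> g t"
    using g by (auto simp: bochner_measurable_def)
  have [measurable]: "(\<lambda>t. norm (s i t - u i t)) \<in> borel_measurable M" for i
    by (rule borel_measurable_simple_function)
      (rule simple_function_compose2[OF s(1) u(1), where h = "\<lambda>x y. norm (x - y)"])
  have "(\<lambda>t. lim (\<lambda>i. norm (s i t - u i t))) \<in> borel_measurable M"
    by measurable
  moreover have "AE t in M. lim (\<lambda>i. norm (s i t - u i t)) = norm (f t - g t)"
    using s(2) u(2) by eventually_elim (auto intro!: limI tendsto_intros)
  ultimately show ?thesis
    by (rule borel_measurable_AE_cong)
qed

section \<open>The Opial-type inequality\<close>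

theorem corollary4p2:
  fixes M :: "'s measure"
    and p :: real
    and F :: "nat \<Rightarrow> 's \<Rightarrow> 'a::banach"
    and g :: "'s \<Rightarrow> real"
  assumes "complete_measure M"
    and "finite_measure M"
    and "1 \<le> p"
    and "opial_property TYPE('a)"
    and "\<forall>n. F n \<in> Lp M p"
    and "\<exists>C. \<forall>n. Lp_norm M p (F n) \<le> C"
    and "AE t in M. weakly_null (\<lambda>n. F n t)"
    and "g \<in> Lp_real M p"
    and "AE t in M. (\<lambda>n. norm (F n t)) \<longlonglongrightarrow> g t"
  shows "\<forall>f \<in> Lp M p. \<not> (AE t in M. f t = 0) \<longrightarrow>
           limsup (\<lambda>n. ereal (Lp_norm M p (F n)))
             < limsup (\<lambda>n. ereal (Lp_norm M p (\<lambda>t. F n t - f t)))"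
proof (intro ballI impI)
  fix f :: "'s \<Rightarrow> 'a"
  assume f: "f \<in> Lp M p" and f_nonzero: "\<not> (AE t in M. f t = 0)"
  have p: "1 \<le> p" by fact
  define a where "a n t = norm (F n t) powr p" for n t
  define b where "b n t = norm (F n t - f t) powr p" for n t
  define h where "h t = norm (f t) powr p" for t
  define A where "A t = \<bar>g t\<bar> powr p" for t
  have int_a: "integrable M (a n)" for n
    using assms(5) by (auto simp: Lp_def Lp_real_def a_def[abs_def])
  have int_h: "integrable M h"
    using f by (auto simp: Lp_def Lp_real_def h_def[abs_def])
  have int_b: "integrable M (b n)" for n
  proof (rule Bochner_Integration.integrable_bound)
    show "integrable M (\<lambda>t. (1/2) powr (1 - p) * (a n t + h t))"
      using int_a int_h by auto
    have "(\<lambda>t. norm (F n t - f t)) \<in> borel_measurable M"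
      using assms(1,5) f by (intro bochner_measurable_norm_diff) (auto simp: Lp_def)
    then show "b n \<in> borel_measurable M"
      unfolding b_def[abs_def] by measurable
    show "AE t in M. norm (b n t) \<le> norm ((1/2) powr (1 - p) * (a n t + h t))"
      unfolding a_def b_def h_def
      using norm_diff_powr_le[OF p] by (auto simp: abs_mult intro!: AE_I2)
  qed
  have norm_F: "Lp_norm M p (F n) powr p = (\<integral>t. a n t \<partial>M)"
    and norm_Ff: "Lp_norm M p (\<lambda>t. F n t - f t) powr p = (\<integral>t. b n t \<partial>M)" for n
    using p by (auto simp: Lp_norm_def Lp_real_norm_def powr_powr a_def b_def)
  have norm_nonneg: "0 \<le> Lp_norm M p u" for u :: "'s \<Rightarrow> 'a"
    by (simp add: Lp_norm_def Lp_real_norm_def)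
  obtain K where K: "\<And>n. Lp_norm M p (F n) \<le> K"
    using assms(6) by blast
  have K0: "0 \<le> K" using order_trans[OF norm_nonneg K] .
  have "AE t in M. ennreal (A t) \<le> liminf (\<lambda>n. ennreal (b n t))
      \<and> (f t \<noteq> 0 \<longrightarrow> ennreal (A t) < liminf (\<lambda>n. ennreal (b n t)))
      \<and> (\<lambda>n. a n t) \<longlonglongrightarrow> A t"
    using assms(7,9)
  proof eventually_elim
    case (elim t)
    have "0 \<le> g t" by (rule LIMSEQ_le_const[OF elim(2)]) auto
    then have lim_a: "(\<lambda>n. a n t) \<longlonglongrightarrow> A t"
      unfolding a_def A_def using p elim(2) by (intro tendsto_powr') (auto intro!: tendsto_intros)
    show ?case
    proof (cases "f t = 0")
      case True
      have "liminf (\<lambda>n. ennreal (b n t)) = ennreal (A t)"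
        using True lim_a by (intro lim_imp_Liminf tendsto_ennrealI) (auto simp: a_def b_def)
      then show ?thesis using True lim_a by simp
    next
      case False
      have "ennreal (A t) < liminf (\<lambda>n. ennreal (b n t))"
        using opial_liminf_powr[OF p assms(4) elim(1) False elim(2)] \<open>0 \<le> g t\<close>
        by (simp add: A_def b_def)
      then show ?thesis using lim_a by simp
    qed
  qed
  then have le: "AE t in M. ennreal (A t) \<le> liminf (\<lambda>n. ennreal (b n t))"
    and less: "AE t in M. f t \<noteq> 0 \<longrightarrow> ennreal (A t) < liminf (\<lambda>n. ennreal (b n t))"
    and lim_a: "AE t in M. (\<lambda>n. a n t) \<longlonglongrightarrow> A t"
    by auto
  have "\<exists>d>0. \<forall>\<^sub>F n in sequentially. (\<integral>t. a n t \<partial>M) + d \<le> (\<integral>t. b n t \<partial>M)"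
  proof (rule integral_gap_of_liminf_gap[where A = A and h = h and K = "K powr p"])
    show "(\<integral>t. a n t \<partial>M) \<le> K powr p" for n
      unfolding norm_F[symmetric] using p K norm_nonneg by (intro powr_mono2) auto
    show "\<exists>C\<ge>0. \<forall>n t. c * a n t \<le> b n t + C * h t" if "0 < c" "c < 1" for c
      using norm_powr_diff_lower_bound[OF p that, where 'a = 'a] unfolding a_def b_def h_def by blast
    show "\<not> (AE t in M. liminf (\<lambda>n. ennreal (b n t)) \<le> ennreal (A t))"
    proof
      assume "AE t in M. liminf (\<lambda>n. ennreal (b n t)) \<le> ennreal (A t)"
      with less have "AE t in M. f t = 0" by eventually_elim auto
      with f_nonzero show False ..
    qed
    show "integrable M A" using assms(8) by (auto simp: Lp_real_def A_def[abs_def])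
  qed (rule int_a int_b int_h le lim_a | simp add: a_def b_def h_def A_def)+
  then obtain d where d: "0 < d"
    and gap: "\<forall>\<^sub>F n in sequentially. (\<integral>t. a n t \<partial>M) + d \<le> (\<integral>t. b n t \<partial>M)"
    by blast
  obtain \<eta> where \<eta>: "0 < \<eta>"
    "\<And>r s. 0 \<le> r \<Longrightarrow> r \<le> K \<Longrightarrow> 0 \<le> s \<Longrightarrow> r powr p + d \<le> s powr p \<Longrightarrow> r + \<eta> \<le> s"
    using uniform_root_gap[OF p d K0] by blast
  let ?u = "\<lambda>n. ereal (Lp_norm M p (F n))"
  let ?v = "\<lambda>n. ereal (Lp_norm M p (\<lambda>t. F n t - f t))"
  have "\<forall>\<^sub>F n in sequentially. ?u n + ereal \<eta> \<le> ?v n"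
    using gap
  proof eventually_elim
    case (elim n)
    then show ?case
      using \<eta>(2)[OF norm_nonneg K[of n] norm_nonneg, of "\<lambda>t. F n t - f t"] norm_F norm_Ff by simp
  qed
  then have "limsup (\<lambda>n. ?u n + ereal \<eta>) \<le> limsup ?v"
    by (rule Limsup_mono)
  moreover have "limsup (\<lambda>n. ?u n + ereal \<eta>) = limsup ?u + ereal \<eta>"
    by (rule Limsup_add_ereal_right) auto
  moreover have "limsup ?u \<le> ereal K" "ereal 0 \<le> limsup ?u"
    using K norm_nonneg by (auto intro!: Limsup_bounded le_Limsup)
  then have "limsup ?u < limsup ?u + ereal \<eta>"
    using \<eta>(1) by (cases "limsup ?u") auto
  ultimately show "limsup ?u < limsup ?v" by simp
qed

end
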